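(* Let $a$ and $x$ be complex numbers with $x\notin\{0,1\}$ and $x+a\ne0$, and suppose that the power series $\sum_{k\ge1}z^k/k^2$ converges absolutely at each of the arguments $z=-\frac{a}{x}$, $\frac1x$, $-a$, $-a\cdot\frac{x-1}{x+a}$ and $\frac{x-1}{x+a}$. Then $$\operatorname{Li}_2\left(-\frac ax\right)-\operatorname{Li}_2\left(\frac1x\right)+\frac{\pi^2}{6}-\operatorname{Li}_2(-a)-\ln(x)\ln\left(\frac{x+a}{x-1}\right)=-\operatorname{Li}_2\left(-a\cdot\frac{x-1}{x+a}\right)+\operatorname{Li}_2\left(\frac{x-1}{x+a}\right).$$
   Context: $\operatorname{Li}_2(z)=\sum_{k\ge1}z^k/k^2$ is the dilogarithm, defined by this series where it converges absolutely (that is, for $|z|\le1$). $\ln$ denotes the principal branch of the complex logarithm. *)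

theory Defs
  imports "HOL-Analysis.Analysis"
begin

text \<open>The summation index is shifted by one: the term at index \<open>n\<close> is \<open>z ^ k / k\<^sup>2\<close>
  with \<open>k = n + 1\<close>.\<close>

definition dilog_term :: "complex \<Rightarrow> nat \<Rightarrow> complex" where
  "dilog_term z n = z ^ Suc n / of_nat (Suc n) ^ 2"

definition dilog_abs_conv :: "complex \<Rightarrow> bool" where
  "dilog_abs_conv z \<longleftrightarrow> summable (\<lambda>n. norm (dilog_term z n))"

text \<open>Only meaningful where the series converges, that is for \<open>norm z \<le> 1\<close>; elsewhere
  \<^const>\<open>suminf\<close> yields an unspecified value.\<close>

definition Li2 :: "complex \<Rightarrow> complex" where
  "Li2 z = (\<Sum>n. dilog_term z n)"

end

theory Submission
  imports Defs "HOL-Complex_Analysis.Complex_Analysis" "HOL-Real_Asymp.Real_Asymp"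
begin

text \<open>Put \<open>u = 1 / x\<close>, \<open>v = - a\<close> and \<open>w = (1 - u) / (1 - u v)\<close>, so that the arguments are
  \<open>u v\<close>, \<open>u\<close>, \<open>v\<close>, \<open>v w\<close> and \<open>w\<close>. The case \<open>v = 1\<close> is trivial. Otherwise continue \<open>Li\<^sub>2\<close>
  analytically to the plane slit along \<open>[1, \<infinity>)\<close> and let \<open>v\<close> move to \<open>0\<close> along a straight line:
  the hypotheses on the absolute values at the end point keep all arguments off the slit (although \<open>w\<close> may
  leave the unit disc), the derivative of the difference of both sides vanishes, and at \<open>v = 0\<close>
  the identity becomes Euler's reflection formula for \<open>u\<close> and \<open>1 - u\<close>.\<close>

subsection \<open>The series on the closed unit disc\<close>

text \<open>For radius above 1 the terms blow up instead of tending to 0. The convergence hypotheses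
  of the theorem enter only through this bound.\<close>

lemma dilog_abs_conv_imp_norm_le_1:
  assumes "dilog_abs_conv z"
  shows "norm z \<le> 1"
proof (rule ccontr)
  define r where "r = norm z"
  assume "\<not> norm z \<le> 1"
  then have r: "r > 1" by (simp add: r_def)
  have "(\<lambda>n. norm (dilog_term z n)) = (\<lambda>n. r ^ Suc n / real (Suc n) ^ 2)"
    by (simp add: dilog_term_def norm_divide norm_power norm_mult r_def del: of_nat_Suc)
  then have "(\<lambda>n. r ^ Suc n / real (Suc n) ^ 2) \<longlonglongrightarrow> 0"
    using assms summable_LIMSEQ_zero unfolding dilog_abs_conv_def by metis
  moreover have "filterlim (\<lambda>n. r ^ Suc n / real (Suc n) ^ 2) at_top sequentially"
    using r by real_asymp
  ultimately show False
    using not_tendsto_and_filterlim_at_infinity filterlim_at_top_imp_at_infinity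
      trivial_limit_sequentially by blast
qed

lemma norm_dilog_term_le:
  assumes "norm z \<le> 1"
  shows "norm (dilog_term z n) \<le> 1 / (real (n + 1))\<^sup>2"
proof -
  have "norm z ^ Suc n \<le> 1" using assms by (intro power_le_one) auto
  then have "norm z ^ Suc n / (real (Suc n))\<^sup>2 \<le> 1 / (real (Suc n))\<^sup>2"
    by (intro divide_right_mono) auto
  then show ?thesis
    unfolding dilog_term_def norm_divide norm_power norm_of_nat by simp
qed

lemma inverse_squares_sums': "(\<lambda>n. 1 / (real (n + 1))\<^sup>2) sums (pi\<^sup>2 / 6)"
  using inverse_squares_sums by (simp only: of_nat_power)

text \<open>Weierstrass M-test with majorant \<open>1 / k^2\<close>. Continuity up to the boundary
  matters because the arguments may lie on the unit circle.\<close>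

lemma continuous_on_Li2: "continuous_on (cball 0 1) Li2"
proof -
  have "uniform_limit (cball 0 1) (\<lambda>n z. \<Sum>i<n. dilog_term z i) (\<lambda>z. \<Sum>i. dilog_term z i) sequentially"
  proof (rule Weierstrass_m_test)
    show "summable (\<lambda>n. 1 / (real (n + 1))\<^sup>2)"
      using inverse_squares_sums' by (rule sums_summable)
  qed (use norm_dilog_term_le in auto)
  then have "continuous_on (cball 0 1) (\<lambda>z. \<Sum>i. dilog_term z i)"
    by (rule uniform_limit_theorem[rotated])
       (auto intro!: always_eventually continuous_intros simp: dilog_term_def simp del: of_nat_Suc)
  then show ?thesis by (simp add: Li2_def[abs_def])
qed

lemma Li2_0: "Li2 0 = 0"
  by (simp add: Li2_def dilog_term_def)

lemma Li2_1: "Li2 1 = of_real pi ^ 2 / 6"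
proof -
  have "(\<lambda>n. of_real (1 / (real (n + 1))\<^sup>2)) sums (of_real (pi\<^sup>2 / 6) :: complex)"
    using inverse_squares_sums' by (simp only: sums_of_real_iff)
  then have "(\<lambda>n. dilog_term 1 n) sums (of_real pi ^ 2 / 6)"
    by (simp add: dilog_term_def)
  then show ?thesis by (simp add: Li2_def sums_iff)
qed

text \<open>The value 1 at 0 is the limit there, which fills the removable singularity.\<close>

definition dilog_deriv :: "complex \<Rightarrow> complex" where
  "dilog_deriv z = (if z = 0 then 1 else - Ln (1 - z) / z)"

lemma Li2_has_field_derivative:
  assumes "norm z < 1"
  shows "(Li2 has_field_derivative dilog_deriv z) (at z)"
proof -
  \<comment> \<open>Division by zero gives \<open>c 0 = 0\<close>, so the power series indexed from
    0 has the same sum as the shifted series defining \<open>Li2\<close>.\<close>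
  define c :: "nat \<Rightarrow> complex" where "c n = 1 / of_nat n ^ 2" for n
  have c_sums: "(\<lambda>n. c n * y ^ n) sums Li2 y" if "norm y \<le> 1" for y
  proof -
    have "summable (\<lambda>n. dilog_term y n)"
      by (rule summable_comparison_test'[OF sums_summable[OF inverse_squares_sums'] norm_dilog_term_le[OF that]])
    then have "(\<lambda>n. dilog_term y n) sums Li2 y" by (simp add: Li2_def summable_sums)
    moreover have "(\<lambda>n. dilog_term y n) = (\<lambda>n. c (Suc n) * y ^ Suc n)"
      by (simp add: dilog_term_def c_def)
    ultimately have "(\<lambda>n. c (Suc n) * y ^ Suc n) sums Li2 y" by simp
    then show ?thesis by (subst (asm) sums_Suc_iff) (simp add: c_def)
  qed
  have "((\<lambda>y. \<Sum>n. c n * y ^ n) has_field_derivative (\<Sum>n. diffs c n * z ^ n)) (at z)"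
    using c_sums[of 1] assms by (intro termdiffs_strong[of _ 1]) (auto simp: sums_iff)
  moreover have "(\<Sum>n. diffs c n * z ^ n) = dilog_deriv z"
  proof (cases "z = 0")
    case True
    then have "(\<Sum>n. diffs c n * z ^ n) = diffs c 0" by (simp only: powser_zero)
    then show ?thesis using True by (simp add: dilog_deriv_def diffs_def c_def)
  next
    case False
    have "(\<lambda>n. - (z ^ n) / of_nat n) sums Ln (1 - z)"
      using Ln_series'[of "- z"] assms by simp
    then have "(\<lambda>n. - (z ^ Suc n) / of_nat (Suc n)) sums Ln (1 - z)"
      by (subst sums_Suc_iff) simp
    then have "(\<lambda>n. - (z ^ Suc n) / of_nat (Suc n) * (- 1 / z)) sums (Ln (1 - z) * (- 1 / z))"
      by (rule sums_mult2)
    moreover have "- (z ^ Suc n) / of_nat (Suc n) * (- 1 / z) = diffs c n * z ^ n" for n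
      using False by (simp add: diffs_def c_def power2_eq_square del: of_nat_Suc)
    ultimately show ?thesis using False by (simp add: sums_iff dilog_deriv_def)
  qed
  ultimately have *: "((\<lambda>y. \<Sum>n. c n * y ^ n) has_field_derivative dilog_deriv z) (at z)" by simp
  show ?thesis
    by (rule has_field_derivative_transform_within_open[OF *, of "ball 0 1"])
       (use assms c_sums in \<open>auto simp: sums_iff\<close>)
qed

subsection \<open>Analytic continuation to the slit plane\<close>

text \<open>The plane slit along [1, infinity) is star-shaped about 0, so the straight path from 0
  stays inside it.\<close>

definition dilog :: "complex \<Rightarrow> complex" where
  "dilog z = contour_integral (linepath 0 z) dilog_deriv"

lemma Re_less_1:
  assumes "norm z \<le> 1" "z \<noteq> 1"
  shows "Re z < 1"
proof (rule ccontr)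
  assume "\<not> Re z < 1"
  moreover have "(Re z)\<^sup>2 + (Im z)\<^sup>2 \<le> 1"
    using assms(1) by (simp add: cmod_def)
  moreover have "Re z \<le> 1" using assms(1) complex_Re_le_cmod[of z] by linarith
  ultimately show False using assms(2) by (simp add: complex_eq_iff)
qed

lemma one_minus_notin_nonpos_Reals:
  fixes z :: complex
  assumes "norm z \<le> 1" "z \<noteq> 1"
  shows "1 - z \<notin> \<real>\<^sub>\<le>\<^sub>0"
  using Re_less_1[OF assms] by (simp add: complex_nonpos_Reals_iff)

lemma open_slit: "open {z :: complex. 1 - z \<notin> \<real>\<^sub>\<le>\<^sub>0}"
proof -
  have "open ((\<lambda>z :: complex. 1 - z) -` (- \<real>\<^sub>\<le>\<^sub>0))"
    by (intro open_vimage continuous_intros) (simp_all add: open_Compl)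
  then show ?thesis by (simp add: vimage_def)
qed

lemma closed_segment_0_slit:
  fixes y z :: complex
  assumes "1 - z \<notin> \<real>\<^sub>\<le>\<^sub>0" "y \<in> closed_segment 0 z"
  shows "1 - y \<notin> \<real>\<^sub>\<le>\<^sub>0"
proof
  assume y: "1 - y \<in> \<real>\<^sub>\<le>\<^sub>0"
  obtain t where t: "0 \<le> t" "t \<le> 1" "y = t *\<^sub>R z"
    using assms(2) by (auto simp: in_segment)
  have *: "1 \<le> t * Re z" "t * Im z = 0"
    using y t(3) by (auto simp: complex_nonpos_Reals_iff)
  then have "t > 0" using t(1) by (cases "t = 0") auto
  moreover have "1 \<le> Re z"
  proof (rule ccontr)
    assume "\<not> 1 \<le> Re z"
    then have "t * Re z < t * 1" using \<open>t > 0\<close> by (intro mult_strict_left_mono) auto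
    then show False using * t by linarith
  qed
  ultimately show False using assms(1) * by (auto simp: complex_nonpos_Reals_iff)
qed

lemma dilog_has_field_derivative:
  assumes z: "1 - z \<notin> \<real>\<^sub>\<le>\<^sub>0"
  shows "(dilog has_field_derivative dilog_deriv z) (at z)"
proof -
  let ?S = "{z :: complex. 1 - z \<notin> \<real>\<^sub>\<le>\<^sub>0}"
  have diff: "dilog_deriv field_differentiable at y" if "y \<in> ?S - {0}" for y
  proof -
    have "((\<lambda>y. - Ln (1 - y) / y) has_field_derivative
        (1 / (1 - y) * y + Ln (1 - y)) / y\<^sup>2) (at y)"
      using that by (auto intro!: derivative_eq_intros simp: power2_eq_square field_simps)
    then have "(dilog_deriv has_field_derivative (1 / (1 - y) * y + Ln (1 - y)) / y\<^sup>2) (at y)"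
      by (rule has_field_derivative_transform_within_open[where S = "- {0}"])
         (use that in \<open>auto simp: dilog_deriv_def\<close>)
    then show ?thesis by (auto simp: field_differentiable_def)
  qed
  \<comment> \<open>Continuity of \<open>dilog_deriv\<close> at 0: its quotient is the difference
    quotient of \<open>- Ln (1 - y)\<close> at 0.\<close>
  have "((\<lambda>y. - Ln (1 - y)) has_field_derivative 1) (at 0)"
    by (auto intro!: derivative_eq_intros)
  then have "((\<lambda>y. - Ln (1 - y) / y) \<longlongrightarrow> 1) (at 0)"
    by (simp add: has_field_derivative_iff)
  then have "(dilog_deriv \<longlongrightarrow> 1) (at 0)"
    by (rule Lim_transform_eventually) (auto simp: dilog_deriv_def eventually_at intro!: exI[of _ 1])
  then have "isCont dilog_deriv 0" by (simp add: isCont_def dilog_deriv_def)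
  then have "isCont dilog_deriv y" if "y \<in> ?S" for y
    using diff[of y] that field_differentiable_imp_continuous_at by (cases "y = 0") auto
  then have cont: "continuous_on ?S dilog_deriv"
    by (simp add: continuous_at_imp_continuous_on)
  have star: "starlike ?S"
    unfolding starlike_def using closed_segment_0_slit by (intro bexI[of _ 0]) auto
  \<comment> \<open>At the exceptional point 0 the existence of a primitive asks only for
    continuity, so differentiability of \<open>dilog_deriv\<close> there need not be shown.\<close>
  obtain p where p: "\<And>y. y \<in> ?S \<Longrightarrow> (p has_field_derivative dilog_deriv y) (at y)"
    using holomorphic_starlike_primitive[OF cont star open_slit, of "{0}"] diff by blast
  have "dilog y = p y - p 0" if "y \<in> ?S" for y
  proof -
    have "(dilog_deriv has_contour_integral (p (pathfinish (linepath 0 y)) - p (pathstart (linepath 0 y))))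
        (linepath 0 y)"
    proof (rule contour_integral_primitive[where S = ?S])
      show "path_image (linepath 0 y) \<subseteq> ?S"
        unfolding path_image_linepath using that closed_segment_0_slit[of y] by blast
    qed (use p has_field_derivative_at_within valid_path_linepath in blast)+
    then show ?thesis by (simp add: dilog_def contour_integral_unique)
  qed
  moreover have "((\<lambda>y. p y - p 0) has_field_derivative dilog_deriv z) (at z)"
    using p[of z] z by (auto intro!: derivative_eq_intros)
  ultimately show ?thesis
    using has_field_derivative_transform_within_open[OF _ open_slit, of "\<lambda>y. p y - p 0" _ z dilog] z
    by simp
qed

lemma dilog_0: "dilog 0 = 0"
  by (simp add: dilog_def)

lemmas dilog_has_field_derivative_chain [derivative_intros] =
  DERIV_chain2[OF dilog_has_field_derivative]

text \<open>The finite set \<open>K\<close> allows for an end point on the unit circle, where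
  \<open>Li2\<close> is only known to be continuous, and for the removable singularity at 0.\<close>

lemma constant_on_closed_segment:
  fixes f :: "complex \<Rightarrow> complex"
  assumes "finite K" "continuous_on (closed_segment a b) f"
    and "\<And>z. z \<in> closed_segment a b - K \<Longrightarrow> (f has_field_derivative 0) (at z)"
  shows "f a = f b"
proof -
  have "(f has_derivative (\<lambda>h. 0)) (at z within closed_segment a b)"
    if "z \<in> closed_segment a b - K" for z
  proof -
    have "(f has_derivative (*) 0) (at z)"
      using assms(3)[OF that] by (simp add: has_field_derivative_def)
    moreover have "(*) (0 :: complex) = (\<lambda>_. 0)" by auto
    ultimately show ?thesis by (simp add: has_derivative_at_withinI)
  qed
  then show ?thesis
    by (rule has_derivative_zero_unique_strong_convex[OF convex_closed_segment assms(1,2)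
          ends_in_segment(2) refl _ ends_in_segment(1)])
qed

lemma DERIV_zero_closed_segment:
  fixes f :: "complex \<Rightarrow> complex"
  assumes "\<And>z. z \<in> closed_segment a b \<Longrightarrow> (f has_field_derivative 0) (at z)"
  shows "f a = f b"
proof (rule constant_on_closed_segment[where K = "{}" and f = f and a = a and b = b])
  show "continuous_on (closed_segment a b) f"
    by (rule DERIV_continuous_on) (rule has_field_derivative_at_within[OF assms])
qed (use assms in simp_all)

text \<open>Both functions vanish at 0 and share their derivative inside the disc; continuity
  carries the equality to the end point \<open>z\<close>, which may have modulus 1.\<close>

lemma dilog_eq_Li2:
  assumes "norm z \<le> 1" "z \<noteq> 1"
  shows "dilog z = Li2 z"
proof -
  have slit: "1 - y \<notin> \<real>\<^sub>\<le>\<^sub>0" if "y \<in> closed_segment 0 z" for y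
    using closed_segment_0_slit one_minus_notin_nonpos_Reals[OF assms] that by blast
  have seg: "closed_segment 0 z \<subseteq> cball 0 1"
    using assms by (intro closed_segment_subset) auto
  have "dilog 0 - Li2 0 = dilog z - Li2 z"
  proof (rule constant_on_closed_segment[where K = "{z}" and f = "\<lambda>y. dilog y - Li2 y" and a = 0 and b = z])
    have "continuous_on (closed_segment 0 z) dilog"
      by (rule DERIV_continuous_on)
         (rule has_field_derivative_at_within[OF dilog_has_field_derivative[OF slit]])
    then show "continuous_on (closed_segment 0 z) (\<lambda>y. dilog y - Li2 y)"
      by (intro continuous_on_diff continuous_on_subset[OF continuous_on_Li2 seg])
    show "((\<lambda>y. dilog y - Li2 y) has_field_derivative 0) (at y)"
      if "y \<in> closed_segment 0 z - {z}" for y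
    proof -
      obtain t where t: "0 \<le> t" "t \<le> 1" "y = t *\<^sub>R z"
        using \<open>y \<in> closed_segment 0 z - {z}\<close> by (auto simp: in_segment)
      then have "t < 1" using \<open>y \<in> closed_segment 0 z - {z}\<close> by (cases "t = 1") auto
      have "norm y = t * norm z" using t by simp
      also have "\<dots> \<le> t * 1" using t assms by (intro mult_left_mono) auto
      finally have "norm y < 1" using \<open>t < 1\<close> by simp
      then show ?thesis
        using slit[of y] that
          DERIV_diff[OF dilog_has_field_derivative Li2_has_field_derivative, of y] by simp
    qed
  qed auto
  then show ?thesis by (simp add: Li2_0 dilog_0)
qed

text \<open>The left-hand side has derivative 0 on the plane without (-infinity, 0] and [1,
  infinity), hence is constant. Its value is the limit as the argument tends to 0 from the right
  along the reals, where the product of logarithms vanishes and \<open>Li2 0 + Li2 1\<close>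
  remains.\<close>

lemma dilog_reflection:
  assumes u: "u \<notin> \<real>\<^sub>\<le>\<^sub>0" "1 - u \<notin> \<real>\<^sub>\<le>\<^sub>0"
  shows "dilog u + dilog (1 - u) + Ln u * Ln (1 - u) = of_real pi ^ 2 / 6"
proof -
  define h where "h z = dilog z + dilog (1 - z) + Ln z * Ln (1 - z)" for z
  have h_eq: "h (1 / 2) = h y" if y: "y \<notin> \<real>\<^sub>\<le>\<^sub>0" "1 - y \<notin> \<real>\<^sub>\<le>\<^sub>0" for y
  proof -
    have "(h has_field_derivative 0) (at z)" if "z \<in> closed_segment (1 / 2) y" for z
    proof -
      have "\<exists>t. 0 \<le> t \<and> t \<le> 1 \<and> z = (1 - t) *\<^sub>R (1 / 2) + t *\<^sub>R y"
        using that by (simp only: in_segment(1))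
      then obtain t where t: "0 \<le> t" "t \<le> 1" "z = (1 - t) *\<^sub>R (1 / 2) + t *\<^sub>R y"
        by blast
      \<comment> \<open>The doubly slit plane is star-shaped about 1/2: \<open>z\<close> is 1/2, or
        non-real, or lies between 1/2 and a real \<open>y\<close> in (0, 1).\<close>
      have zT: "z \<notin> \<real>\<^sub>\<le>\<^sub>0 \<and> 1 - z \<notin> \<real>\<^sub>\<le>\<^sub>0"
      proof (cases "t = 0 \<or> Im y \<noteq> 0")
        case True
        then show ?thesis using t by (auto simp: complex_nonpos_Reals_iff)
      next
        case False
        then have "t > 0" "0 < Re y" "Re y < 1" using t(1) y by (auto simp: complex_nonpos_Reals_iff)
        define q where "q = t * Re y"
        have "0 < q" "q < t" using \<open>t > 0\<close> \<open>0 < Re y\<close> \<open>Re y < 1\<close> by (auto simp: q_def)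
        moreover have "2 * Re z = 1 - t + 2 * q" using t(3) by (simp add: q_def)
        ultimately have "0 < Re z" "Re z < 1" using t(1,2) by simp_all
        then show ?thesis by (auto simp: complex_nonpos_Reals_iff)
      qed
      then have "z \<noteq> 0" "z \<noteq> 1" by auto
      moreover have "(h has_field_derivative
          dilog_deriv z - dilog_deriv (1 - z) + (Ln (1 - z) / z - Ln z / (1 - z))) (at z)"
        unfolding h_def using zT
        by (auto intro!: derivative_eq_intros simp: divide_inverse mult.commute)
      ultimately show ?thesis by (simp add: dilog_deriv_def)
    qed
    then show ?thesis by (rule DERIV_zero_closed_segment)
  qed
  have "((\<lambda>x. h (of_real x)) \<longlongrightarrow> of_real pi ^ 2 / 6) (at_right 0)"
  proof -
    have "((\<lambda>x. Li2 (of_real x)) \<longlongrightarrow> Li2 0) (at_right 0)"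
      by (rule continuous_on_tendsto_compose[OF continuous_on_Li2])
         (auto intro!: tendsto_eq_intros eventually_at_rightI[of 0 1] simp: norm_of_real)
    moreover have "((\<lambda>x. Li2 (1 - of_real x)) \<longlongrightarrow> Li2 1) (at_right 0)"
    proof (rule continuous_on_tendsto_compose[OF continuous_on_Li2])
      have "norm (1 - of_real x :: complex) = \<bar>1 - x\<bar>" for x
        by (metis norm_of_real of_real_1 of_real_diff)
      then show "\<forall>\<^sub>F x in at_right 0. 1 - complex_of_real x \<in> cball 0 1"
        by (auto intro!: eventually_at_rightI[of 0 1])
    qed (auto intro!: tendsto_eq_intros)
    moreover have "((\<lambda>x :: real. ln x * ln (1 - x)) \<longlongrightarrow> 0) (at_right 0)" by real_asymp
    then have "((\<lambda>x. complex_of_real (ln x * ln (1 - x))) \<longlongrightarrow> 0) (at_right 0)"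
      using tendsto_of_real by fastforce
    ultimately have lim: "((\<lambda>x. Li2 (of_real x) + Li2 (1 - of_real x) + complex_of_real (ln x * ln (1 - x)))
        \<longlongrightarrow> Li2 0 + Li2 1 + 0) (at_right 0)"
      by (intro tendsto_add)
    show ?thesis
    proof (rule Lim_transform_eventually)
      show "((\<lambda>x. Li2 (of_real x) + Li2 (1 - of_real x) + complex_of_real (ln x * ln (1 - x)))
        \<longlongrightarrow> of_real pi ^ 2 / 6) (at_right 0)"
        using lim by (simp add: Li2_0 Li2_1)
      show "\<forall>\<^sub>F x in at_right 0. Li2 (of_real x) + Li2 (1 - of_real x) + complex_of_real (ln x * ln (1 - x))
          = h (of_real x)"
      proof (rule eventually_at_rightI[of 0 1])
        fix x :: real assume x: "x \<in> {0<..<1}"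
        have "norm (1 - of_real x :: complex) = \<bar>1 - x\<bar>"
          by (metis norm_of_real of_real_1 of_real_diff)
        moreover have "Ln (1 - of_real x) = of_real (ln (1 - x))"
          using x Ln_of_real[of "1 - x"] by simp
        ultimately show "Li2 (of_real x) + Li2 (1 - of_real x) + complex_of_real (ln x * ln (1 - x))
          = h (of_real x)"
          using x by (simp add: h_def dilog_eq_Li2 Ln_of_real)
      qed auto
    qed
  qed
  moreover have "\<forall>\<^sub>F x in at_right 0. h (of_real x) = h u"
    by (rule eventually_at_rightI[of 0 1])
       (use h_eq[OF u] in \<open>auto simp: complex_nonpos_Reals_iff intro!: h_eq[symmetric, THEN trans]\<close>)
  then have "((\<lambda>x. h (of_real x)) \<longlongrightarrow> h u) (at_right 0)"
    by (rule tendsto_eventually)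
  ultimately have "h u = of_real pi ^ 2 / 6"
    using tendsto_unique trivial_limit_at_right_real by blast
  then show ?thesis by (simp add: h_def)
qed

subsection \<open>The five-term relation\<close>

text \<open>Both logarithms have imaginary part in (-pi/2, pi/2), so their difference stays in the
  principal strip.\<close>

lemma Re_pos_divide:
  assumes "Re a > 0" "Re b > 0"
  shows "a / b \<notin> \<real>\<^sub>\<le>\<^sub>0" "Ln (a / b) = Ln a - Ln b"
proof -
  have nz: "a \<noteq> 0" "b \<noteq> 0" using assms by auto
  show "a / b \<notin> \<real>\<^sub>\<le>\<^sub>0"
  proof
    assume "a / b \<in> \<real>\<^sub>\<le>\<^sub>0"
    then obtain r where "a / b = of_real r" "r \<le> 0" by (auto elim: nonpos_Reals_cases)
    then have "a = of_real r * b" using nz by (simp add: field_simps)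
    then have "Re a \<le> 0" using \<open>r \<le> 0\<close> assms by (simp add: mult_nonpos_nonneg)
    then show False using assms by simp
  qed
  have "\<bar>Im (Ln a)\<bar> < pi / 2" "\<bar>Im (Ln b)\<bar> < pi / 2"
    using assms Re_Ln_pos_lt nz by auto
  then show "Ln (a / b) = Ln a - Ln b"
    using nz by (intro Ln_unique) (auto simp: exp_diff)
qed

text \<open>Real form of: a point of the segment from \<open>1\<close> to \<open>u = X + \<i> Y\<close> is not a multiple
  \<open>t z\<close>, \<open>0 \<le> t \<le> 1\<close>, of a point \<open>z \<noteq> u\<close> that is at most as far from the origin as \<open>u\<close> and
  lies weakly to its left.\<close>

lemma segment_avoids:
  fixes X Y P Q s t :: real
  assumes "X < 1" "Y = 0 \<Longrightarrow> X > 0" "P\<^sup>2 + Q\<^sup>2 \<le> X\<^sup>2 + Y\<^sup>2" "P \<le> X"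
    and s: "0 < s" "s \<le> 1" and t: "0 \<le> t" "t \<le> 1"
    and eq: "t * P = 1 - s + s * X" "t * Q = s * Y"
  shows "P = X \<and> Q = Y"
proof -
  have "t * P \<le> t * X" using assms by (intro mult_left_mono) auto
  then have le: "1 - s \<le> (t - s) * X" using eq by (simp add: algebra_simps)
  \<comment> \<open>If \<open>t > s\<close>, then \<open>X < 1\<close> gives
    \<open>1 - s < t - s\<close>, which is absurd. If \<open>t = s\<close>, then
    \<open>s = 1\<close> and the two points agree. If \<open>t < s\<close>, then \<open>X\<close> is
    nonpositive, so P is at least as large as X in absolute value; hence Q is at most as large as Y,
    and \<open>t * Q = s * Y\<close> with \<open>Y\<close> nonzero forces
    \<open>s \<le> t\<close>.\<close>
  consider "t > s" | "t = s" | "t < s" by linarith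
  then show ?thesis
  proof cases
    case 1
    then have "(t - s) * X < (t - s) * 1" using assms by (intro mult_strict_left_mono) auto
    from le_less_trans[OF le this] have False using t by simp
    then show ?thesis ..
  next
    case 2
    then show ?thesis using le s eq by auto
  next
    case 3
    have X: "X \<le> 0"
    proof (rule ccontr)
      assume "\<not> X \<le> 0"
      then have "(t - s) * X < 0" using 3 by (simp add: mult_neg_pos)
      from le_less_trans[OF le this] show False using s by simp
    qed
    then have "Y \<noteq> 0" using assms(2) by auto
    have "X\<^sup>2 \<le> P\<^sup>2" using X assms(4) by (metis abs_le_square_iff abs_of_nonpos neg_le_iff_le order_trans)
    then have "Q\<^sup>2 \<le> Y\<^sup>2" using assms(3) by linarith
    have "s\<^sup>2 * Y\<^sup>2 = t\<^sup>2 * Q\<^sup>2" using eq(2) by (metis power_mult_distrib)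
    also have "\<dots> \<le> t\<^sup>2 * Y\<^sup>2" using \<open>Q\<^sup>2 \<le> Y\<^sup>2\<close> by (intro mult_left_mono) auto
    finally have "s\<^sup>2 \<le> t\<^sup>2" using \<open>Y \<noteq> 0\<close> by simp
    then show ?thesis using 3 t s by (simp add: power2_le_iff_abs_le)
  qed
qed

lemma five_term_dilog:
  assumes u: "norm u \<le> 1" "u \<noteq> 0" "u \<noteq> 1" and v: "norm v \<le> 1" "v \<noteq> 1"
    and uv: "u * v \<noteq> 1" and le: "norm (1 - u) \<le> norm (1 - u * v)"
  shows "u \<notin> \<real>\<^sub>\<le>\<^sub>0"
    and "dilog (u * v) - dilog u + of_real pi ^ 2 / 6 - dilog v + Ln u * (Ln (1 - u * v) - Ln (1 - u))
         = - dilog (v * ((1 - u) / (1 - u * v))) + dilog ((1 - u) / (1 - u * v))"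
proof -
  have sq: "(Re (u * v))\<^sup>2 + (Im (u * v))\<^sup>2 \<le> (Re u)\<^sup>2 + (Im u)\<^sup>2"
  proof -
    have "norm (u * v) \<le> norm u * 1" unfolding norm_mult using v by (intro mult_left_mono) auto
    then show ?thesis by (simp add: cmod_def)
  qed
  \<comment> \<open>Expanding the squares in \<open>le\<close> compares
    \<open>|u|^2 - 2 Re u\<close> with \<open>|u v|^2 - 2 Re (u v)\<close>, and \<open>|u v|\<close>
    is at most \<open>|u|\<close>.\<close>
  have Re_le: "Re (u * v) \<le> Re u"
  proof -
    have "(Re (1 - u))\<^sup>2 + (Im (1 - u))\<^sup>2 \<le> (Re (1 - u * v))\<^sup>2 + (Im (1 - u * v))\<^sup>2"
      using le by (simp only: cmod_def real_sqrt_le_iff)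
    then have "(1 - Re u)\<^sup>2 + (Im u)\<^sup>2 \<le> (1 - Re (u * v))\<^sup>2 + (Im (u * v))\<^sup>2"
      by (simp only: minus_complex.sel one_complex.sel diff_0 power2_minus)
    then show ?thesis using sq unfolding power2_diff by linarith
  qed
  have ne: "u * v \<noteq> u" using u v by simp
  have Re_u: "Re u < 1" using Re_less_1 u by blast
  \<comment> \<open>For real \<open>u \<le> 0\<close> the bounds \<open>Re_le\<close> and
    \<open>sq\<close> would force \<open>u * v = u\<close>. This keeps \<open>u\<close> off the
    branch cut of \<open>Ln\<close>.\<close>
  have Im0: "Re u > 0" if "Im u = 0"
  proof (rule ccontr)
    assume "\<not> Re u > 0"
    then have "(Re u)\<^sup>2 \<le> (Re (u * v))\<^sup>2"
      using Re_le by (metis abs_le_square_iff abs_of_nonpos neg_le_iff_le not_less order_trans)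
    moreover have "(Im u)\<^sup>2 = 0" using that by simp
    ultimately have "(Im (u * v))\<^sup>2 \<le> 0" and eq: "(Re u)\<^sup>2 = (Re (u * v))\<^sup>2"
      using sq zero_le_power2[of "Im (u * v)"] by linarith+
    then have "Im (u * v) = Im u" using that by (simp only: power2_less_eq_zero_iff)
    moreover have "Re u = Re (u * v) \<or> Re u = - Re (u * v)"
      using eq by (simp only: power2_eq_iff)
    then have "Re (u * v) = Re u" using Re_le \<open>\<not> Re u > 0\<close> by linarith
    ultimately show False using ne complex_eqI by blast
  qed
  then show u_slit: "u \<notin> \<real>\<^sub>\<le>\<^sub>0" by (auto simp: complex_nonpos_Reals_iff)
  have u_slit': "1 - u \<notin> \<real>\<^sub>\<le>\<^sub>0" using u one_minus_notin_nonpos_Reals by blast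
  define w where "w V = (1 - u) / (1 - u * V)" for V
  have V: "Re (1 - V) > 0" "Re (1 - u * V) > 0" "1 - w V \<notin> \<real>\<^sub>\<le>\<^sub>0" "1 - V * w V \<notin> \<real>\<^sub>\<le>\<^sub>0"
    "1 - V \<notin> \<real>\<^sub>\<le>\<^sub>0" "1 - u * V \<notin> \<real>\<^sub>\<le>\<^sub>0"
    "Ln (1 - V * w V) = Ln (1 - V) - Ln (1 - u * V)"
    if "V \<in> closed_segment 0 v" for V
  proof -
    have "\<exists>t. 0 \<le> t \<and> t \<le> 1 \<and> V = (1 - t) *\<^sub>R 0 + t *\<^sub>R v"
      using that by (simp only: in_segment(1))
    then obtain t where t: "0 \<le> t" "t \<le> 1" "V = t *\<^sub>R v"
      by auto
    have pos: "Re (1 - t *\<^sub>R y) > 0" if "norm y \<le> 1" "y \<noteq> 1" for y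
    proof -
      have "Re y < 1" using that Re_less_1 by blast
      have "t * Re y < 1"
      proof (cases "t = 0")
        case False
        then have "t * Re y < t * 1" using \<open>Re y < 1\<close> t by (intro mult_strict_left_mono) auto
        then show ?thesis using t by linarith
      qed auto
      then show ?thesis by simp
    qed
    have "norm (u * v) \<le> 1" unfolding norm_mult using u v by (simp add: mult_le_one)
    then show ReV: "Re (1 - V) > 0" and ReuV: "Re (1 - u * V) > 0"
      using pos[of v] pos[of "u * v"] uv v t by simp_all
    then show "1 - V \<notin> \<real>\<^sub>\<le>\<^sub>0" "1 - u * V \<notin> \<real>\<^sub>\<le>\<^sub>0" by (auto simp: complex_nonpos_Reals_iff)
    have nz: "1 - u * V \<noteq> 0" using ReuV by (metis less_irrefl zero_complex.sel(1))
    have "1 - V * w V = (1 - V) / (1 - u * V)"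
      using nz by (simp add: w_def field_simps)
    then show "1 - V * w V \<notin> \<real>\<^sub>\<le>\<^sub>0" "Ln (1 - V * w V) = Ln (1 - V) - Ln (1 - u * V)"
      using Re_pos_divide[OF ReV ReuV] by simp_all
    show "1 - w V \<notin> \<real>\<^sub>\<le>\<^sub>0"
    proof
      assume "1 - w V \<in> \<real>\<^sub>\<le>\<^sub>0"
      then obtain r where r: "1 - w V = of_real r" "r \<le> 0" by (auto elim: nonpos_Reals_cases)
      \<comment> \<open>If \<open>w V = 1 - r\<close> were on the slit, clearing denominators would
        give \<open>t u v = 1 - s (1 - u)\<close>: a point of the segment from 0 to
        \<open>u v\<close> on the segment from 1 to \<open>u\<close>. \<open>segment_avoids\<close>
        then yields \<open>u v = u\<close>, contradicting \<open>ne\<close>.\<close>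
      define s where "s = 1 / (1 - r)"
      have s: "0 < s" "s \<le> 1" using r by (auto simp: s_def)
      have "w V = of_real (1 - r)" using r(1) by (simp add: algebra_simps)
      then have "1 - u = of_real (1 - r) * (1 - u * V)"
        using nz by (simp add: w_def field_simps)
      then have "of_real s * (1 - u) = of_real (s * (1 - r)) * (1 - u * V)"
        by (simp only: of_real_mult mult.assoc)
      also have "s * (1 - r) = 1" using r by (simp add: s_def)
      finally have "t *\<^sub>R (u * v) = 1 - of_real s * (1 - u)" using t by (simp add: algebra_simps)
      then have "Re (t *\<^sub>R (u * v)) = Re (1 - of_real s * (1 - u))"
         "Im (t *\<^sub>R (u * v)) = Im (1 - of_real s * (1 - u))" by simp_all
      then have "t * Re (u * v) = 1 - s + s * Re u" "t * Im (u * v) = s * Im u"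
        by (simp_all add: algebra_simps)
      then have "Re (u * v) = Re u \<and> Im (u * v) = Im u"
        using segment_avoids[OF Re_u Im0 sq Re_le s t(1,2)] by blast
      then show False using ne complex_eqI by blast
    qed
  qed
  have w': "(w has_field_derivative u * (1 - u) / (1 - u * z)\<^sup>2) (at z)"
    if "z \<in> closed_segment 0 v" for z
  proof -
    have "1 - u * z \<noteq> 0" using V(6)[OF that] by auto
    then show ?thesis unfolding w_def
      by (auto intro!: derivative_eq_intros simp: power2_eq_square)
  qed
  \<comment> \<open>Here \<open>1 - w V = u (1 - V) / (1 - u V)\<close>, but \<open>u\<close> may
    have negative real part, so \<open>Re_pos_divide\<close> is not enough. A jump by a multiple of
    2 pi i is excluded by continuation from \<open>V = 0\<close>, where
    \<open>w 0 = 1 - u\<close>.\<close>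
  have log_w: "Ln (1 - w V) = Ln u + Ln (1 - V) - Ln (1 - u * V)" if "V \<in> closed_segment 0 v" for V
  proof -
    define f where "f V = Ln (1 - w V) - Ln u - Ln (1 - V) + Ln (1 - u * V)" for V
    have "(f has_field_derivative 0) (at z)" if "z \<in> closed_segment 0 V" for z
    proof -
      have z: "z \<in> closed_segment 0 v"
        using that \<open>V \<in> closed_segment 0 v\<close> by (meson ends_in_segment(1) subset_closed_segment subsetD)
      have nz: "1 - u * z \<noteq> 0" "1 - z \<noteq> 0" using V(5,6)[OF z] by auto
      have alg: "- (u * c / d\<^sup>2) / (u * e / d) + 1 / e - u / d = (d - u * e - c) / (d * e)"
        if "d \<noteq> 0" "e \<noteq> 0" for c d e
        using that u(2) by (simp add: field_simps power2_eq_square)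
      have w_eq: "1 - w z = u * (1 - z) / (1 - u * z)" using nz by (simp add: w_def field_simps)
      have "- (u * (1 - u) / (1 - u * z)\<^sup>2) / (1 - w z) + 1 / (1 - z) - u / (1 - u * z) = 0"
        unfolding w_eq alg[OF nz] by (simp add: algebra_simps)
      then show ?thesis unfolding f_def using V[OF z]
        by (auto intro!: derivative_eq_intros w'[OF z] simp: field_simps)
    qed
    then have "f 0 = f V" by (rule DERIV_zero_closed_segment)
    then show ?thesis by (simp add: f_def w_def algebra_simps)
  qed
  define F where "F V = dilog (u * V) - dilog V + Ln u * (Ln (1 - u * V) - Ln (1 - u))
    + dilog (V * w V) - dilog (w V)" for V
  have F': "(F has_field_derivative u * dilog_deriv (u * z) - dilog_deriv z - Ln u * (u / (1 - u * z))
      + dilog_deriv (z * w z) * (w z + z * (u * (1 - u) / (1 - u * z)\<^sup>2))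
      - dilog_deriv (w z) * (u * (1 - u) / (1 - u * z)\<^sup>2)) (at z)"
    if "z \<in> closed_segment 0 v" for z
    unfolding F_def using V(3-6)[OF that]
    by (auto intro!: derivative_eq_intros w'[OF that] simp: divide_inverse mult_ac)
  have "F 0 = F v"
  \<comment> \<open>At 0 the quotient formula for \<open>dilog_deriv\<close> does not apply;
    continuity of \<open>F\<close> suffices there.\<close>
  proof (rule constant_on_closed_segment[where K = "{0}" and f = F and a = 0 and b = v])
    show "continuous_on (closed_segment 0 v) F"
      by (rule DERIV_continuous_on) (rule has_field_derivative_at_within[OF F'])
    fix z assume z: "z \<in> closed_segment 0 v - {0}"
    then have zs: "z \<in> closed_segment 0 v" and z0: "z \<noteq> 0" by auto
    have nz: "1 - u * z \<noteq> 0" using V(6)[OF zs] by auto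
    have nz': "1 - u \<noteq> 0" using u by simp
    have w0: "w z \<noteq> 0" using nz nz' by (simp add: w_def)
    define D where "D = 1 - u * z"
    define A where "A = Ln (1 - z)"
    define B where "B = Ln D"
    define C where "C = Ln u"
    have wz: "w z = (1 - u) / D" by (simp add: w_def D_def)
    have "dilog_deriv (u * z) = - B / (u * z)" "dilog_deriv z = - A / z"
      "dilog_deriv (z * w z) = - (A - B) / (z * w z)" "dilog_deriv (w z) = - (C + A - B) / w z"
      using V(7)[OF zs] log_w[OF zs] u z0 w0
      by (simp_all add: dilog_deriv_def A_def B_def C_def D_def)
    \<comment> \<open>The logarithmic derivatives of \<open>V * w V\<close> and \<open>w V\<close>
      at \<open>z\<close> are \<open>1 / z + u / D\<close> and \<open>u / D\<close>. Then
      \<open>F'\<close> is linear in \<open>A\<close>, \<open>B\<close>, \<open>C\<close>, and each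
      coefficient cancels.\<close>
    moreover have alg: "- X / (z * (c / D)) * (c / D + z * (u * c / D\<^sup>2)) = - X * (1 / z + u / D)"
      "- X / (c / D) * (u * c / D\<^sup>2) = - X * (u / D)" if "c \<noteq> 0" for c X
      using that z0 nz unfolding D_def[symmetric]
      by (simp_all add: divide_simps power2_eq_square) (simp_all add: algebra_simps)
    ultimately have "u * dilog_deriv (u * z) - dilog_deriv z - Ln u * (u / (1 - u * z))
      + dilog_deriv (z * w z) * (w z + z * (u * (1 - u) / (1 - u * z)\<^sup>2))
      - dilog_deriv (w z) * (u * (1 - u) / (1 - u * z)\<^sup>2) =
      u * (- B / (u * z)) - (- A / z) - C * (u / D) + - (A - B) * (1 / z + u / D) - - (C + A - B) * (u / D)"
      unfolding wz C_def[symmetric] D_def[symmetric] by (simp only: alg[OF nz'])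
    also have "\<dots> = 0" using u by (simp add: algebra_simps add_divide_distrib diff_divide_distrib)
    finally show "(F has_field_derivative 0) (at z)" using F'[OF zs] by simp
  qed auto
  moreover have "F 0 = - Ln u * Ln (1 - u) - dilog (1 - u)"
    by (simp add: F_def w_def dilog_0)
  ultimately have "F v = - Ln u * Ln (1 - u) - dilog (1 - u)" by simp
  also have "\<dots> = dilog u - of_real pi ^ 2 / 6"
    unfolding dilog_reflection[OF u_slit u_slit', symmetric] by simp
  finally have "F v = dilog u - of_real pi ^ 2 / 6" .
  then show "dilog (u * v) - dilog u + of_real pi ^ 2 / 6 - dilog v + Ln u * (Ln (1 - u * v) - Ln (1 - u))
         = - dilog (v * ((1 - u) / (1 - u * v))) + dilog ((1 - u) / (1 - u * v))"
    unfolding F_def w_def by (simp add: algebra_simps)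
qed

theorem theorem1:
  fixes a x :: complex
  assumes "x \<noteq> 0" and "x \<noteq> 1" and "x + a \<noteq> 0"
    and "dilog_abs_conv (- (a / x))"
    and "dilog_abs_conv (1 / x)"
    and "dilog_abs_conv (- a)"
    and "dilog_abs_conv (- a * ((x - 1) / (x + a)))"
    and "dilog_abs_conv ((x - 1) / (x + a))"
  shows "Li2 (- (a / x)) - Li2 (1 / x) + of_real pi ^ 2 / 6 - Li2 (- a)
           - ln x * ln ((x + a) / (x - 1))
         = - Li2 (- a * ((x - 1) / (x + a))) + Li2 ((x - 1) / (x + a))"
\<comment> \<open>For \<open>a = - 1\<close> the last three arguments are 1, the first two coincide
  and the second logarithm is 0, so only \<open>Li2 1\<close> remains to be evaluated.\<close>
proof (cases "a = - 1")
  case True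
  then show ?thesis using assms(2) by (simp add: Li2_1)
next
  case False
  define u where "u = 1 / x"
  define v where "v = - a"
  define w where "w = (1 - u) / (1 - u * v)"
  have w: "(x - 1) / (x + a) = w"
    using assms(1-3) by (simp add: w_def u_def v_def divide_simps)
  have uv: "- (a / x) = u * v" by (simp add: u_def v_def)
  have u: "norm u \<le> 1" "u \<noteq> 0" "u \<noteq> 1"
    using assms(1,2) dilog_abs_conv_imp_norm_le_1[OF assms(5)] by (auto simp: u_def)
  have v: "norm v \<le> 1" "v \<noteq> 1"
    using dilog_abs_conv_imp_norm_le_1[OF assms(6)] False by (auto simp: v_def minus_equation_iff)
  have uv1: "u * v \<noteq> 1"
    using assms(1,3) by (auto simp: u_def v_def divide_simps add_eq_0_iff)
  have norms: "norm (u * v) \<le> 1" "norm w \<le> 1" "norm (v * w) \<le> 1"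
    using assms(4,7,8) dilog_abs_conv_imp_norm_le_1 by (simp_all only: uv w v_def)
  have le: "norm (1 - u) \<le> norm (1 - u * v)"
    using norms(2) uv1 by (simp add: w_def norm_divide divide_simps split: if_splits)
  \<comment> \<open>\<open>w = 1\<close> would mean \<open>u v = u\<close>, and
    \<open>v w = 1\<close> would mean \<open>v = 1\<close>. With these cases excluded,
    \<open>dilog_eq_Li2\<close> applies to both arguments.\<close>
  have w1: "w \<noteq> 1" using uv1 u v by (auto simp: w_def divide_simps)
  have vw1: "v * w \<noteq> 1"
    using uv1 v by (auto simp: w_def divide_simps algebra_simps)
  note five = five_term_dilog[OF u v uv1 le]
  have "Ln ((x + a) / (x - 1)) = Ln ((1 - u * v) / (1 - u))"
    using assms(1,2) by (intro arg_cong[of _ _ Ln]) (simp add: u_def v_def divide_simps)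
  also have "\<dots> = Ln (1 - u * v) - Ln (1 - u)"
    using Re_less_1[OF u(1,3)] Re_less_1[OF norms(1) uv1] by (intro Re_pos_divide(2)) auto
  finally have ln2: "Ln ((x + a) / (x - 1)) = Ln (1 - u * v) - Ln (1 - u)" .
  \<comment> \<open>This needs \<open>u\<close> off the negative real axis, where inversion would
    shift the principal logarithm by 2 pi i.\<close>
  have "Ln x = - Ln u"
    using Ln_inverse[OF five(1)] by (simp add: u_def inverse_eq_divide)
  with five(2) ln2 show ?thesis
    unfolding uv w using u v uv1 norms w1 vw1
    by (simp add: dilog_eq_Li2 flip: w_def v_def u_def)
qed

end
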